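(* Let $n\ge 3$ and let $U\in\mathbf{M}_n(\mathbb{C})$ satisfy $\left\Vert U^{*}U-I\right\Vert\le \frac34$. Let $$V_{1}=\frac{1}{2}\left(U+\left(U^{-1}\right)^{*}\right),\qquad V=\frac{1}{2}\left(V_{1}+\left(V_{1}^{-1}\right)^{*}\right).$$ If $Q\in\mathbf{M}_n(\mathbb{C})$ is unitary and $T\in\mathbf{M}_n(\mathbb{C})$ is upper triangular with $V=QTQ^{*}$, and if $D$ is the diagonal unitary matrix with $$D_{jj}=\frac{1}{|T_{jj}|}T_{jj}\qquad(1\le j\le n),$$ then $$\left\Vert U-QDQ^{*}\right\Vert \leq \tfrac{7}{10}\sqrt{n}\left\Vert U^{*}U-I\right\Vert ^{2}+\tfrac{7}{10}\left\Vert U^{*}U-I\right\Vert .$$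
   Context: $\mathbf{M}_n(\mathbb{C})$ is the set of $n\times n$ complex matrices, $U^{*}$ is the conjugate transpose of $U$, $I$ is the identity matrix, and $\|A\|=\sup_{\mathbf{v}\ne 0}\|A\mathbf{v}\|_2/\|\mathbf{v}\|_2$ is the operator norm. *)

theory Defs
  imports "HOL-Analysis.Analysis"
begin

definition conj_transpose :: "complex^'n^'m \<Rightarrow> complex^'m^'n" where
  "conj_transpose A = (\<chi> i j. cnj (A $ j $ i))"

text \<open>
  The norm on \<^typ>\<open>complex^'n\<close> is the Euclidean one, and \<^const>\<open>onorm\<close> is the supremum of
  \<open>norm (A *v x) / norm x\<close> over all \<open>x\<close>; the vector \<open>x = 0\<close> contributes the harmless value \<open>0\<close>.
\<close>
definition op_norm :: "complex^'n^'m \<Rightarrow> real" where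
  "op_norm A = onorm (\<lambda>x. A *v x)"

definition unitary :: "complex^'n^'n \<Rightarrow> bool" where
  "unitary Q \<longleftrightarrow> conj_transpose Q ** Q = mat 1 \<and> Q ** conj_transpose Q = mat 1"

text \<open>
  The order on the index type plays the role of the usual order on \<open>{1..n}\<close>.
\<close>
definition upper_triangular :: "complex^('n::{finite,linorder})^('n::{finite,linorder}) \<Rightarrow> bool" where
  "upper_triangular T \<longleftrightarrow> (\<forall>i j. j < i \<longrightarrow> T $ i $ j = 0)"

definition diag_matrix :: "('n \<Rightarrow> complex) \<Rightarrow> complex^'n^'n" where
  "diag_matrix d = (\<chi> i j. if i = j then d i else 0)"

end

theory Submission
  imports Defs
begin

text \<open>
  Write \<open>U b = s\<^sub>b w\<^sub>b\<close> for orthonormal families \<open>b\<close>, \<open>w\<^sub>b\<close> (a singular value decomposition);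
  \<open>\<parallel>U\<^sup>*U - I\<parallel> \<le> \<epsilon>\<close> then says \<open>\<bar>s\<^sup>2 - 1\<bar> \<le> \<epsilon>\<close>, and \<open>\<epsilon> \<le> 3/4\<close> gives \<open>s \<ge> 1/2\<close>.  Both averaging
  steps keep the singular vectors and replace \<open>s\<close> by \<open>f s = (s + 1/s)/2\<close>, so everything about \<open>V\<close> is read
  off from the scalar function \<open>f (f s)\<close>: on \<open>s \<ge> 1/2\<close> it satisfies
  \<open>\<bar>s - f (f s)\<bar> \<le> 7/10 \<bar>s\<^sup>2 - 1\<bar>\<close> and \<open>1 \<le> (f (f s))\<^sup>2 \<le> 1 + 49/100 (s\<^sup>2 - 1)\<^sup>4\<close>.  Hence
  \<open>\<parallel>U - V\<parallel> \<le> 7/10 \<epsilon>\<close>, and \<open>T\<close> is expanding with columns of squared norm at most \<open>1 + 49/100 \<epsilon>\<^sup>4\<close>.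
  Being also triangular, \<open>T\<close> has diagonal entries of modulus at least \<open>1\<close>, so each column of \<open>T - D\<close>
  has norm at most \<open>7/10 \<epsilon>\<^sup>2\<close>.
  Throughout, \<open>\<complex>\<^sup>n\<close> is regarded as a real inner product space with the real part of the Hermitian product.
\<close>

section \<open>Orthonormal families and the real spectral theorem\<close>

text \<open>A family rather than a set, so that the left singular vectors \<open>w b\<close> can be
  indexed by the right ones \<open>b\<close>; a plain set is the family
  \<open>\<lambda>b. b\<close>. On complex vectors the product is the real one, so an orthonormal
  basis of \<open>complex^'n\<close> has twice as many members as there are coordinates.\<close>

definition orthonormal_on :: "'b set \<Rightarrow> ('b \<Rightarrow> 'a::real_inner) \<Rightarrow> bool" where
  "orthonormal_on B w \<longleftrightarrow> (\<forall>a\<in>B. \<forall>b\<in>B. w a \<bullet> w b = (if a = b then 1 else 0))"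

lemma orthonormal_on_ident_independent:
  fixes B :: "'a::euclidean_space set"
  assumes "orthonormal_on B (\<lambda>b. b)"
  shows "independent B"
proof (rule pairwise_orthogonal_independent)
  show "pairwise orthogonal B"
    using assms by (auto simp: orthonormal_on_def pairwise_def orthogonal_def)
  show "0 \<notin> B"
    using assms by (force simp: orthonormal_on_def)
qed

text \<open>Maximise the Rayleigh quotient over the unit sphere of \<open>C\<close> and let
  \<open>l\<close> be its maximum, attained at \<open>x\<close>. The form \<open>g\<close> is then
  nonnegative on \<open>C\<close> and zero at \<open>x\<close>, so its first variation at
  \<open>x\<close> along \<open>z = l *\<^sub>R x - f x\<close> vanishes; that variation is twice
  the squared norm of \<open>z\<close>.\<close>

lemma selfadjoint_eigenvector_in_subspace:
  fixes f :: "'a::euclidean_space \<Rightarrow> 'a"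
  assumes lin: "linear f" and sym: "\<And>x y. f x \<bullet> y = x \<bullet> f y"
    and C: "subspace C" "C \<noteq> {0}" and inv: "\<And>x. x \<in> C \<Longrightarrow> f x \<in> C"
  obtains x l where "x \<in> C" "norm x = 1" "f x = l *\<^sub>R x"
proof -
  obtain c where c: "c \<in> C" "c \<noteq> 0"
    using C subspace_0 by blast
  define S where "S = C \<inter> sphere 0 1"
  have "compact S"
    unfolding S_def using closed_subspace[OF C(1)] by (intro closed_Int_compact) auto
  moreover have "(1 / norm c) *\<^sub>R c \<in> S"
    using c C by (auto simp: S_def subspace_scale)
  moreover have "continuous_on S (\<lambda>x. f x \<bullet> x)"
    using lin by (intro continuous_on_inner linear_continuous_on continuous_on_id)
      (simp add: linear_conv_bounded_linear)
  ultimately obtain x where x: "x \<in> S" and xmax: "\<And>y. y \<in> S \<Longrightarrow> f y \<bullet> y \<le> f x \<bullet> x"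
    using continuous_attains_sup[of S "\<lambda>x. f x \<bullet> x"] by blast
  define l where "l = f x \<bullet> x"
  define g where "g y = l * (y \<bullet> y) - f y \<bullet> y" for y
  have xC: "x \<in> C" and nx: "norm x = 1"
    using x by (auto simp: S_def)
  have g_nonneg: "g y \<ge> 0" if "y \<in> C" for y
  proof (cases "y = 0")
    case True
    then show ?thesis by (simp add: g_def)
  next
    case False
    have "(1 / norm y) *\<^sub>R y \<in> S"
      using that C False by (auto simp: S_def subspace_scale)
    from xmax[OF this] have "(f y \<bullet> y) / (norm y)\<^sup>2 \<le> l"
      using lin by (simp add: linear_scale l_def power2_eq_square)
    then show ?thesis
      using False by (simp add: g_def field_simps power2_norm_eq_inner)
  qed
  define z where "z = l *\<^sub>R x - f x"
  have zC: "z \<in> C"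
    unfolding z_def using C xC inv by (intro subspace_diff subspace_scale) auto
  have g_line: "g (x + t *\<^sub>R z) = 2 * t * (z \<bullet> z) + t\<^sup>2 * g z" for t
  proof -
    have "g x = 0"
      using nx by (simp add: g_def l_def norm_eq_1)
    moreover have "g (x + t *\<^sub>R z) = g x + 2 * t * (l * (x \<bullet> z) - f x \<bullet> z) + t\<^sup>2 * g z"
      using lin sym[of z x]
      by (simp add: g_def linear_add linear_scale inner_add_left inner_add_right power2_eq_square
          algebra_simps inner_commute)
    moreover have "l * (x \<bullet> z) - f x \<bullet> z = z \<bullet> z"
      by (simp add: z_def inner_diff_left)
    ultimately show ?thesis by simp
  qed
  have "z = 0"
  proof (rule ccontr)
    assume "z \<noteq> 0"
    define a where "a = z \<bullet> z"
    have a: "a > 0" using \<open>z \<noteq> 0\<close> by (simp add: a_def)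
    have gz: "g z \<ge> 0" using g_nonneg zC .
    \<comment> \<open>A step short enough for the linear term of \<open>g_line\<close> to beat the
      quadratic one; the \<open>+ 1\<close> covers \<open>g z = 0\<close>.\<close>
    define s where "s = a / (g z + 1)"
    have s: "s > 0" using a gz by (simp add: s_def)
    have "0 \<le> g (x + (- s) *\<^sub>R z)"
      using C xC zC by (intro g_nonneg subspace_add subspace_scale) auto
    then have "0 \<le> s * (s * g z - 2 * a)"
      unfolding g_line by (simp add: a_def algebra_simps power2_eq_square)
    then have "2 * a \<le> s * g z"
      using s by (simp add: zero_le_mult_iff)
    moreover have "s * g z \<le> s * (g z + 1)" using s by simp
    moreover have "s * (g z + 1) = a" using gz by (simp add: s_def)
    ultimately show False using a by simp
  qed
  then have "f x = l *\<^sub>R x" by (simp add: z_def)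
  with xC nx show ?thesis using that by blast
qed

text \<open>Orthonormal sets of eigenvectors have bounded size, so a largest one exists. Its
  orthogonal complement is invariant under \<open>f\<close> by symmetry, and a nonzero complement
  would supply one more eigenvector.\<close>

lemma selfadjoint_eigenbasis:
  fixes f :: "'a::euclidean_space \<Rightarrow> 'a"
  assumes lin: "linear f" and sym: "\<And>x y. f x \<bullet> y = x \<bullet> f y"
  obtains B l where "finite B" "orthonormal_on B (\<lambda>b. b)" "span B = UNIV"
    "\<And>b. b \<in> B \<Longrightarrow> f b = l b *\<^sub>R b"
proof -
  define P where "P B \<longleftrightarrow> orthonormal_on B (\<lambda>b. b) \<and> (\<forall>b\<in>B. \<exists>l. f b = l *\<^sub>R b)" for B
  have Pfin: "finite B \<and> card B \<le> DIM('a)" if "P B" for B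
    using that orthonormal_on_ident_independent independent_bound by (auto simp: P_def)
  have "P {}" by (simp add: P_def orthonormal_on_def)
  then obtain B where B: "P B" and Bmax: "\<And>B'. P B' \<Longrightarrow> card B' \<le> card B"
    using ex_has_greatest_nat[of P "{}" card "Suc DIM('a)"] Pfin by (auto simp: less_Suc_eq_le)
  have ortho: "orthonormal_on B (\<lambda>b. b)" and eig: "\<forall>b\<in>B. \<exists>l. f b = l *\<^sub>R b"
    using B by (auto simp: P_def)
  have finB: "finite B" using Pfin B by blast
  define C where "C = {y. \<forall>b\<in>B. b \<bullet> y = 0}"
  have subC: "subspace C"
    by (auto simp: C_def subspace_def inner_add_right)
  have "C = {0}"
  proof (rule ccontr)
    assume "C \<noteq> {0}"
    have "f y \<in> C" if "y \<in> C" for y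
      unfolding C_def
    proof (intro CollectI ballI)
      fix b assume b: "b \<in> B"
      then obtain l where "f b = l *\<^sub>R b" using eig by blast
      then show "b \<bullet> f y = 0"
        using that b sym[of b y] by (simp add: C_def)
    qed
    then obtain x l where x: "x \<in> C" "norm x = 1" "f x = l *\<^sub>R x"
      using selfadjoint_eigenvector_in_subspace[OF lin sym subC \<open>C \<noteq> {0}\<close>] by metis
    have xx: "x \<bullet> x = 1" using x by (simp add: norm_eq_1)
    then have "x \<notin> B" using x by (auto simp: C_def)
    moreover have "P (insert x B)"
      unfolding P_def orthonormal_on_def
      using ortho eig x xx \<open>x \<notin> B\<close> by (auto simp: orthonormal_on_def C_def inner_commute)
    ultimately show False
      using Bmax[of "insert x B"] finB by simp
  qed
  have "span B = UNIV"
  proof (rule ccontr)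
    assume "span B \<noteq> UNIV"
    then obtain a where "a \<noteq> 0" "\<forall>x\<in>span B. a \<bullet> x = 0"
      using span_not_UNIV_orthogonal by blast
    then have "a \<in> C" by (auto simp: C_def span_base inner_commute)
    then show False using \<open>C = {0}\<close> \<open>a \<noteq> 0\<close> by simp
  qed
  moreover obtain l where "\<And>b. b \<in> B \<Longrightarrow> f b = l b *\<^sub>R b"
    using eig by metis
  ultimately show ?thesis using that finB ortho by blast
qed

lemma orthonormal_basis_expansion:
  fixes B :: "'a::euclidean_space set"
  assumes "finite B" "orthonormal_on B (\<lambda>b. b)" "span B = UNIV"
  shows "(\<Sum>b\<in>B. (x \<bullet> b) *\<^sub>R b) = x"
proof -
  let ?z = "(\<Sum>b\<in>B. (x \<bullet> b) *\<^sub>R b) - x"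
  have "?z \<bullet> c = 0" if "c \<in> B" for c
  proof -
    have "(\<Sum>b\<in>B. (x \<bullet> b) *\<^sub>R b) \<bullet> c = (\<Sum>b\<in>B. if b = c then x \<bullet> b else 0)"
      unfolding inner_sum_left using assms(2) that
      by (intro sum.cong) (auto simp: orthonormal_on_def)
    then show ?thesis
      using that assms(1) by (simp add: inner_diff_left)
  qed
  then have "orthogonal ?z ?z"
    using orthogonal_to_span[of ?z B ?z] assms(3) by (auto simp: orthogonal_def)
  then show ?thesis by (simp add: orthogonal_def)
qed

lemma norm_sum_orthonormal:
  assumes "finite B" "orthonormal_on B w"
  shows "(norm (\<Sum>b\<in>B. c b *\<^sub>R w b))\<^sup>2 = (\<Sum>b\<in>B. (c b)\<^sup>2)"
proof -
  have "(norm (\<Sum>b\<in>B. c b *\<^sub>R w b))\<^sup>2 = (\<Sum>a\<in>B. \<Sum>b\<in>B. c a * c b * (w a \<bullet> w b))"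
    unfolding power2_norm_eq_inner inner_sum_left unfolding inner_sum_right
    by (simp add: mult_ac)
  also have "\<dots> = (\<Sum>a\<in>B. \<Sum>b\<in>B. if a = b then (c a)\<^sup>2 else 0)"
    using assms(2) by (intro sum.cong refl) (auto simp: orthonormal_on_def power2_eq_square)
  finally show ?thesis using assms(1) by simp
qed

text \<open>Reduces norm bounds to bounds on coefficients. The \<open>s b\<close> may have any sign,
  which allows the differences of singular values occurring for \<open>U - V\<close>.\<close>

lemma norm_linear_orthonormal:
  fixes f :: "'a::euclidean_space \<Rightarrow> 'b::real_inner"
  assumes "linear f" "finite B" "orthonormal_on B (\<lambda>b. b)" "span B = UNIV" "orthonormal_on B w"
    and "\<And>b. b \<in> B \<Longrightarrow> f b = s b *\<^sub>R w b"
  shows "(norm (f x))\<^sup>2 = (\<Sum>b\<in>B. (x \<bullet> b)\<^sup>2 * (s b)\<^sup>2)"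
proof -
  have "f x = f (\<Sum>b\<in>B. (x \<bullet> b) *\<^sub>R b)"
    using assms by (simp add: orthonormal_basis_expansion)
  also have "\<dots> = (\<Sum>b\<in>B. ((x \<bullet> b) * s b) *\<^sub>R w b)"
    using assms by (simp add: linear_sum linear_scale)
  finally show ?thesis
    using assms norm_sum_orthonormal[of B w "\<lambda>b. (x \<bullet> b) * s b"] by (simp add: power_mult_distrib)
qed

lemma norm_orthonormal_basis:
  fixes x :: "'a::euclidean_space"
  assumes "finite B" "orthonormal_on B (\<lambda>b. b)" "span B = UNIV"
  shows "(norm x)\<^sup>2 = (\<Sum>b\<in>B. (x \<bullet> b)\<^sup>2)"
  using norm_linear_orthonormal[of "\<lambda>x. x" B "\<lambda>b. b" "\<lambda>_. 1" x] assms by (simp add: linear_ident)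

section \<open>Complex matrices as real-linear maps\<close>

lemma linear_complex_matrix: "linear (\<lambda>x. (A :: complex^'n^'m) *v x)"
proof (rule linearI)
  show "A *v (x + y) = A *v x + A *v y" for x y
    by (rule matrix_vector_right_distrib)
  show "A *v (c *\<^sub>R x) = c *\<^sub>R (A *v x)" for c x
    by (simp add: vec_eq_iff matrix_vector_mult_def scaleR_right.sum)
qed

lemma norm_le_op_norm: "norm (A *v x) \<le> op_norm A * norm x"
  unfolding op_norm_def
  using linear_complex_matrix[of A] by (intro onorm) (simp add: linear_conv_bounded_linear)

text \<open>Taking real parts of the Hermitian adjoint identity keeps it valid, so real-linear
  spectral theory applies to complex matrices.\<close>

lemma inner_matrix_conj_transpose:
  fixes A :: "complex^'n^'m"
  shows "(A *v x) \<bullet> y = x \<bullet> (conj_transpose A *v y)"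
proof -
  have *: "(a * b) \<bullet> c = b \<bullet> (cnj a * c)" for a b c :: complex
    by (simp add: inner_complex_def algebra_simps)
  have "(A *v x) \<bullet> y = (\<Sum>i\<in>UNIV. \<Sum>j\<in>UNIV. (A$i$j * x$j) \<bullet> y$i)"
    by (simp add: inner_vec_def matrix_vector_mult_def inner_sum_left)
  also have "\<dots> = (\<Sum>j\<in>UNIV. \<Sum>i\<in>UNIV. x$j \<bullet> (cnj (A$i$j) * y$i))"
    unfolding * by (rule sum.swap)
  also have "\<dots> = x \<bullet> (conj_transpose A *v y)"
    by (simp add: inner_vec_def matrix_vector_mult_def conj_transpose_def inner_sum_right)
  finally show ?thesis .
qed

lemma conj_transpose_matrix_mult:
  "conj_transpose (A ** B) = conj_transpose B ** conj_transpose A"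
  by (simp add: vec_eq_iff conj_transpose_def matrix_matrix_mult_def mult.commute)

lemma conj_transpose_conj_transpose [simp]: "conj_transpose (conj_transpose A) = A"
  by (simp add: vec_eq_iff conj_transpose_def)

lemma conj_transpose_mat_1 [simp]: "conj_transpose (mat 1) = mat 1"
  by (simp add: vec_eq_iff conj_transpose_def mat_def)

lemma norm_unitary:
  assumes "unitary Q"
  shows "norm (Q *v x) = norm x" "norm (conj_transpose Q *v x) = norm x"
  using assms inner_matrix_conj_transpose[of Q x "Q *v x"]
    inner_matrix_conj_transpose[of "conj_transpose Q" x "conj_transpose Q *v x"]
  by (simp_all add: unitary_def matrix_vector_mul_assoc norm_eq_sqrt_inner)

text \<open>Triangle inequality over the columns, then Cauchy-Schwarz of the moduli of the entries
  of \<open>x\<close> against the constant 1. This is the source of the factor \<open>sqrt n\<close>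
  in the final bound.\<close>

lemma norm_le_sum_columns:
  fixes A :: "complex^'n^'n"
  assumes "\<And>j. norm (column j A) \<le> k"
  shows "norm (A *v x) \<le> sqrt (real CARD('n)) * k * norm x"
proof -
  have k: "0 \<le> k" using assms norm_ge_zero order_trans by blast
  have "A *v x = (\<Sum>j\<in>UNIV. x$j *s column j A)"
    by (rule matrix_mult_sum)
  also have "norm \<dots> \<le> (\<Sum>j\<in>UNIV. norm (x$j) * k)"
  proof (rule sum_norm_le)
    fix j
    have "norm (x$j *s column j A) = norm (x$j) * norm (column j A)"
      by (simp add: norm_vec_def norm_mult L2_set_right_distrib)
    then show "norm (x$j *s column j A) \<le> norm (x$j) * k"
      using assms[of j] by (simp add: mult_left_mono)
  qed
  also have "\<dots> = (\<Sum>j\<in>UNIV. \<bar>norm (x$j)\<bar> * \<bar>1\<bar>) * k"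
    by (simp add: sum_distrib_right)
  also have "\<dots> \<le> (L2_set (\<lambda>j. norm (x$j)) UNIV * L2_set (\<lambda>_. 1) (UNIV :: 'n set)) * k"
    using k by (intro mult_right_mono L2_set_mult_ineq)
  also have "\<dots> = sqrt (real CARD('n)) * k * norm x"
    by (simp add: norm_vec_def L2_set_def)
  finally show ?thesis .
qed

section \<open>Singular values under the averaging step\<close>

text \<open>The eigenvectors of \<open>U\<^sup>*U\<close> have orthogonal images under
  \<open>U\<close>, of squared length equal to the eigenvalue \<open>l b\<close>. Applying
  \<open>U\<^sup>*U - I\<close> to a unit eigenvector puts \<open>l b\<close> within
  \<open>e\<close> of 1, hence above 0.\<close>

lemma singular_system_exists:
  fixes U :: "complex^'n^'n"
  assumes "op_norm (conj_transpose U ** U - mat 1) \<le> e" "e < 1"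
  obtains B w s where "finite B" "orthonormal_on B (\<lambda>b. b)" "span B = UNIV"
    "orthonormal_on B w" "\<And>b. b \<in> B \<Longrightarrow> U *v b = s b *\<^sub>R w b"
    "\<And>b. b \<in> B \<Longrightarrow> s b > 0" "\<And>b. b \<in> B \<Longrightarrow> \<bar>(s b)\<^sup>2 - 1\<bar> \<le> e"
proof -
  let ?H = "conj_transpose U ** U"
  have sym: "(?H *v x) \<bullet> y = x \<bullet> (?H *v y)" for x y
    by (simp add: inner_matrix_conj_transpose conj_transpose_matrix_mult)
  obtain B l where B: "finite B" "orthonormal_on B (\<lambda>b. b)" "span B = UNIV"
    and eig: "\<And>b. b \<in> B \<Longrightarrow> ?H *v b = l b *\<^sub>R b"
    using selfadjoint_eigenbasis[OF linear_complex_matrix sym] by blast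
  have l: "\<bar>l b - 1\<bar> \<le> e" if "b \<in> B" for b
  proof -
    have nb: "norm b = 1" using B that by (simp add: orthonormal_on_def norm_eq_1)
    have "(?H - mat 1) *v b = (l b - 1) *\<^sub>R b"
      using eig[OF that] by (simp add: matrix_vector_mult_diff_rdistrib algebra_simps)
    then have "\<bar>l b - 1\<bar> = norm ((?H - mat 1) *v b)" using nb by simp
    also have "\<dots> \<le> e" using norm_le_op_norm[of "?H - mat 1" b] nb assms by simp
    finally show ?thesis .
  qed
  have lpos: "l b > 0" if "b \<in> B" for b
    using l[OF that] assms(2) by linarith
  define s where "s b = sqrt (l b)" for b
  define w where "w b = (1 / s b) *\<^sub>R (U *v b)" for b
  have s: "s b > 0" "(s b)\<^sup>2 = l b" if "b \<in> B" for b
    using lpos[OF that] by (auto simp: s_def)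
  have "orthonormal_on B w"
    unfolding orthonormal_on_def
  proof (intro ballI)
    fix a b assume ab: "a \<in> B" "b \<in> B"
    have "(U *v a) \<bullet> (U *v b) = l b * (a \<bullet> b)"
      using eig[OF ab(2)] by (simp add: inner_matrix_conj_transpose matrix_vector_mul_assoc)
    then have "w a \<bullet> w b = l b * (a \<bullet> b) / (s a * s b)"
      by (simp add: w_def)
    then show "w a \<bullet> w b = (if a = b then 1 else 0)"
      using ab B(2) s[OF ab(2)] by (auto simp: orthonormal_on_def power2_eq_square)
  qed
  moreover have "U *v b = s b *\<^sub>R w b" if "b \<in> B" for b
    using s(1)[OF that] by (simp add: w_def)
  ultimately show ?thesis
    using that[of B w s] B s l by simp
qed

text \<open>Expanding in the basis \<open>B\<close> shows that the adjoint of \<open>A\<close> sends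
  \<open>w b\<close> to \<open>s b *\<^sub>R b\<close>. Hence the inverse adjoint sends
  \<open>b\<close> to \<open>(1 / s b) *\<^sub>R w b\<close>: same vectors, inverted singular
  value.\<close>

lemma singular_system_averaging:
  fixes A :: "complex^'n^'n"
  assumes B: "finite B" "orthonormal_on B (\<lambda>b. b)" "span B = UNIV" and w: "orthonormal_on B w"
    and A: "\<And>b. b \<in> B \<Longrightarrow> A *v b = s b *\<^sub>R w b" and s: "\<And>b. b \<in> B \<Longrightarrow> s b > 0"
    and b: "b \<in> B"
  shows "((1 / 2) *\<^sub>R (A + conj_transpose (matrix_inv A))) *v b = ((s b + 1 / s b) / 2) *\<^sub>R w b"
proof -
  \<comment> \<open>\<open>matrix_inv\<close> is a choice that is meaningful only for invertible
    matrices, so a trivial kernel is shown first.\<close>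
  have "x = 0" if "A *v x = 0" for x
  proof -
    have "(\<Sum>b\<in>B. (x \<bullet> b)\<^sup>2 * (s b)\<^sup>2) = 0"
      using norm_linear_orthonormal[OF linear_complex_matrix B w A, of x] that by simp
    then have "\<forall>b\<in>B. x \<bullet> b = 0"
      using B(1) s by (subst (asm) sum_nonneg_eq_0_iff) fastforce+
    then show "x = 0"
      using orthonormal_basis_expansion[OF B, of x] by simp
  qed
  then have "invertible A"
    using invertible_left_inverse matrix_left_invertible_ker by blast
  then have inv: "A ** matrix_inv A = mat 1"
    unfolding matrix_inv_def invertible_def by (rule someI2_ex) simp
  define M where "M = conj_transpose (matrix_inv A)"
  have M: "M ** conj_transpose A = mat 1"
    using arg_cong[OF inv, of conj_transpose] by (simp add: M_def conj_transpose_matrix_mult)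
  have "conj_transpose A *v w b = (\<Sum>c\<in>B. ((conj_transpose A *v w b) \<bullet> c) *\<^sub>R c)"
    by (rule orthonormal_basis_expansion[OF B, symmetric])
  also have "\<dots> = (\<Sum>c\<in>B. if c = b then s b *\<^sub>R b else 0)"
  proof (rule sum.cong[OF refl])
    fix c assume c: "c \<in> B"
    have "(conj_transpose A *v w b) \<bullet> c = w b \<bullet> (A *v c)"
      by (simp add: inner_matrix_conj_transpose)
    also have "\<dots> = (if c = b then s b else 0)"
      using A[OF c] w b c by (auto simp: orthonormal_on_def)
    finally show "((conj_transpose A *v w b) \<bullet> c) *\<^sub>R c = (if c = b then s b *\<^sub>R b else 0)"
      by simp
  qed
  also have "\<dots> = s b *\<^sub>R b" using b B(1) by simp
  finally have "M *v (conj_transpose A *v w b) = s b *\<^sub>R (M *v b)"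
    by (simp add: linear_scale[OF linear_complex_matrix])
  then have "w b = s b *\<^sub>R (M *v b)"
    by (simp add: matrix_vector_mul_assoc M)
  then have Mb: "M *v b = (1 / s b) *\<^sub>R w b"
    using s[OF b] by simp
  have "((1 / 2) *\<^sub>R (A + M)) *v b = (1 / 2) *\<^sub>R (A *v b + M *v b)"
    by (simp add: vec_eq_iff matrix_vector_mult_def scaleR_right.sum sum.distrib
        distrib_right scaleR_add_right)
  also have "\<dots> = ((s b + 1 / s b) / 2) *\<^sub>R w b"
    by (simp add: A[OF b] Mb scaleR_add_right scaleR_add_left add_divide_distrib)
  finally show ?thesis by (simp add: M_def)
qed

section \<open>Scalar estimates for two averaging steps\<close>

context
  fixes s f g :: real
  assumes s: "s \<ge> 1 / 2" and f: "f = (s + 1 / s) / 2" and g: "g = (f + 1 / f) / 2"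
begin

private lemma g_eq: "g = (s ^ 4 + 6 * s\<^sup>2 + 1) / (4 * s * (s\<^sup>2 + 1))"
proof -
  have "s\<^sup>2 + 1 \<noteq> 0" by (smt (verit) zero_le_power2)
  moreover have "f = (s\<^sup>2 + 1) / (2 * s)"
    using s by (simp add: f field_simps power2_eq_square)
  ultimately show ?thesis
    using s unfolding g by (simp add: divide_simps) algebra
qed

lemma two_averages_displacement: "\<bar>s - g\<bar> \<le> 7 / 10 * \<bar>s\<^sup>2 - 1\<bar>"
proof -
  define d where "d = 4 * s * (s\<^sup>2 + 1)"
  have d: "d > 0" using s by (simp add: d_def add_nonneg_pos)
  have "s * d - (s ^ 4 + 6 * s\<^sup>2 + 1) = (s\<^sup>2 - 1) * (1 + 3 * s\<^sup>2)"
    unfolding d_def by algebra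
  then have "s - g = (s\<^sup>2 - 1) * ((1 + 3 * s\<^sup>2) / d)"
    using d unfolding g_eq d_def[symmetric] by (simp add: field_simps)
  then have "\<bar>s - g\<bar> = (1 + 3 * s\<^sup>2) / d * \<bar>s\<^sup>2 - 1\<bar>"
    using d by (simp add: abs_mult)
  also have "\<dots> \<le> 7 / 10 * \<bar>s\<^sup>2 - 1\<bar>"
  proof (rule mult_right_mono)
    \<comment> \<open>\<open>7 / 10\<close> is the value of the quotient at
      \<open>s = 1 / 2\<close>, so \<open>s - 1 / 2\<close> divides the difference; the remaining
      quadratic is written as a completed square plus a positive constant.\<close>
    have "7 / 10 * d - (1 + 3 * s\<^sup>2) = (s - 1 / 2) * (14 / 5 * (s - 2 / 7)\<^sup>2 + 62 / 35)"
      unfolding d_def by algebra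
    also have "\<dots> \<ge> 0" using s by simp
    finally show "(1 + 3 * s\<^sup>2) / d \<le> 7 / 10" using d by (simp add: pos_divide_le_eq)
  qed simp
  finally show ?thesis .
qed

text \<open>The numerator of \<open>g\<^sup>2\<close> exceeds its denominator \<open>d\<close> by
  exactly the fourth power of \<open>s\<^sup>2 - 1\<close>; so \<open>g\<close> is at least 1 in
  modulus and its square has a fourth-order excess.\<close>

lemma two_averages_square: "1 \<le> g\<^sup>2" "g\<^sup>2 \<le> 1 + 49 / 100 * (s\<^sup>2 - 1) ^ 4"
proof -
  define d where "d = 16 * s\<^sup>2 * (s\<^sup>2 + 1)\<^sup>2"
  have s2: "s\<^sup>2 \<ge> 1 / 4" using power_mono[OF s, of 2] by (simp add: power2_eq_square)
  have "1 / 4 * 1\<^sup>2 \<le> s\<^sup>2 * (s\<^sup>2 + 1)\<^sup>2"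
    using s2 by (intro mult_mono power_mono) auto
  then have d: "d \<ge> 4" by (simp add: d_def)
  have "(4 * s * (s\<^sup>2 + 1))\<^sup>2 = d" unfolding d_def by algebra
  then have "g\<^sup>2 = (s ^ 4 + 6 * s\<^sup>2 + 1)\<^sup>2 / d"
    unfolding g_eq by (simp add: power_divide)
  moreover have "(s ^ 4 + 6 * s\<^sup>2 + 1)\<^sup>2 = d + (s\<^sup>2 - 1) ^ 4"
    unfolding d_def by algebra
  ultimately have g2: "g\<^sup>2 = 1 + (s\<^sup>2 - 1) ^ 4 / d"
    using d by (simp add: add_divide_distrib)
  have p: "(s\<^sup>2 - 1) ^ 4 \<ge> 0" by simp
  show "1 \<le> g\<^sup>2" using g2 d p by simp
  \<comment> \<open>The crude bound \<open>d \<ge> 4\<close> suffices, since \<open>1 / 4\<close> is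
    below \<open>49 / 100\<close>, the square of \<open>7 / 10\<close>.\<close>
  have "(s\<^sup>2 - 1) ^ 4 / d \<le> (s\<^sup>2 - 1) ^ 4 / 4"
    using d p by (intro divide_left_mono) auto
  then show "g\<^sup>2 \<le> 1 + 49 / 100 * (s\<^sup>2 - 1) ^ 4"
    using g2 p by linarith
qed

end

section \<open>Triangular matrices close to isometries\<close>

text \<open>Vectors supported on indices up to \<open>j\<close> form an invariant subspace
  \<open>S\<close>, and the injective \<open>T\<close> maps it onto itself by dimension. The
  preimage \<open>x\<close> in \<open>S\<close> of the \<open>j\<close>-th unit vector has norm at
  most 1 by expansion, while row \<open>j\<close> reads
  \<open>T $ j $ j * x $ j = 1\<close>.\<close>

lemma expanding_upper_triangular_diagonal:
  fixes T :: "complex ^ ('n :: {finite, linorder}) ^ ('n :: {finite, linorder})"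
  assumes T: "upper_triangular T" and exp: "\<And>x. norm x \<le> norm (T *v x)"
  shows "1 \<le> cmod (T $ j $ j)"
proof -
  define S where "S = {x :: complex ^ ('n :: {finite, linorder}). \<forall>i>j. x $ i = 0}"
  have S: "subspace S" by (auto simp: S_def subspace_def)
  have TS: "T *v x \<in> S" if "x \<in> S" for x
    unfolding S_def
  proof (intro CollectI allI impI)
    fix i assume i: "j < i"
    have "T $ i $ k * x $ k = 0" for k
      using T that i by (cases "k < i") (auto simp: upper_triangular_def S_def)
    then show "(T *v x) $ i = 0"
      unfolding matrix_vector_mult_def by (simp only: vec_lambda_beta sum.neutral_const)
  qed
  have "inj ((*v) T)"
  proof (rule injI)
    fix x y assume "T *v x = T *v y"
    then have "T *v (x - y) = 0" by (simp add: matrix_vector_mult_diff_distrib)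
    then show "x = y" using exp[of "x - y"] by simp
  qed
  then have "inj_on ((*v) T) (span S)"
    by (rule inj_on_subset) simp
  then have "dim ((*v) T ` S) = dim S"
    by (rule dim_image_eq[OF linear_complex_matrix])
  then have "(*v) T ` S = S"
    using TS by (intro subspace_dim_equal[OF linear_subspace_image[OF linear_complex_matrix S] S]) auto
  moreover have "axis j 1 \<in> S" by (auto simp: S_def axis_def)
  ultimately obtain x where x: "x \<in> S" "T *v x = axis j 1"
    by (metis imageE)
  have "1 = (T *v x) $ j" by (simp add: x(2) axis_def)
  also have "\<dots> = (\<Sum>k\<in>UNIV. if k = j then T $ j $ j * x $ j else 0)"
    unfolding matrix_vector_mult_def vec_lambda_beta
  proof (rule sum.cong[OF refl])
    show "T $ j $ k * x $ k = (if k = j then T $ j $ j * x $ j else 0)" for k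
      using T x(1) by (cases k j rule: linorder_cases) (auto simp: upper_triangular_def S_def)
  qed
  finally have "1 = T $ j $ j * x $ j" by simp
  then have "1 = cmod (T $ j $ j) * cmod (x $ j)"
    by (metis norm_mult norm_one)
  moreover have "cmod (x $ j) \<le> 1"
    using exp[of x] Finite_Cartesian_Product.norm_nth_le[of x j] by (simp add: x(2))
  ultimately show ?thesis
    by (metis mult.right_neutral mult_left_mono norm_ge_zero)
qed

text \<open>With \<open>t\<close> the modulus of the diagonal entry, subtracting its phase leaves
  modulus \<open>t - 1\<close> and does not touch the rest of the column. The squared norm is
  therefore at most \<open>k\<^sup>2 - 2 * (t - 1)\<close>, and \<open>t \<ge> 1\<close>.\<close>

lemma column_diff_phase_bound:
  fixes T :: "complex^'n^'n"
  assumes diag: "1 \<le> cmod (T $ j $ j)" and col: "(norm (column j T))\<^sup>2 \<le> 1 + k\<^sup>2" and "0 \<le> k"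
  shows "norm (column j (T - diag_matrix (\<lambda>j. complex_of_real (1 / cmod (T $ j $ j)) * T $ j $ j))) \<le> k"
    (is "norm (column j (T - ?D)) \<le> k")
proof -
  define t where "t = cmod (T $ j $ j)"
  have norm_column: "(norm (column j A))\<^sup>2 = (cmod (A $ j $ j))\<^sup>2 + (\<Sum>i\<in>UNIV - {j}. (cmod (A $ i $ j))\<^sup>2)"
    for A :: "complex^'n^'n"
    by (simp add: norm_vec_def L2_set_def sum_nonneg column_def sum.remove[of UNIV j])
  have "(T - ?D) $ j $ j = complex_of_real (1 - 1 / t) * T $ j $ j"
    by (simp add: diag_matrix_def t_def algebra_simps)
  then have "cmod ((T - ?D) $ j $ j) = \<bar>1 - 1 / t\<bar> * t"
    by (simp only: norm_mult norm_of_real t_def)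
  also have "\<dots> = t - 1"
  proof -
    have "1 / t \<le> 1" "t \<noteq> 0" using diag by (auto simp: t_def divide_le_eq_1)
    then show ?thesis by (simp add: left_diff_distrib)
  qed
  finally have "(norm (column j (T - ?D)))\<^sup>2 = (t - 1)\<^sup>2 + (\<Sum>i\<in>UNIV - {j}. (cmod (T $ i $ j))\<^sup>2)"
    unfolding norm_column by (simp add: diag_matrix_def)
  also have "\<dots> = (t - 1)\<^sup>2 + ((norm (column j T))\<^sup>2 - t\<^sup>2)"
    unfolding norm_column by (simp add: t_def)
  also have "\<dots> \<le> (t - 1)\<^sup>2 + (1 + k\<^sup>2 - t\<^sup>2)"
    using col by simp
  also have "\<dots> \<le> k\<^sup>2"
    using diag by (simp add: t_def power2_eq_square algebra_simps)
  finally show ?thesis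
    using \<open>0 \<le> k\<close> by (rule power2_le_imp_le)
qed

section \<open>Combining the displacement of \<open>V\<close> from \<open>U\<close> with that of
  \<open>D\<close> from \<open>T\<close>\<close>

theorem theorem10:
  fixes U V1 V Q T D :: "complex ^ ('n :: {finite, linorder}) ^ ('n :: {finite, linorder})"
  assumes "CARD('n) \<ge> 3"
    and "op_norm (conj_transpose U ** U - mat 1) \<le> 3 / 4"
    and "V1 = (1 / 2) *\<^sub>R (U + conj_transpose (matrix_inv U))"
    and "V = (1 / 2) *\<^sub>R (V1 + conj_transpose (matrix_inv V1))"
    and "unitary Q"
    and "upper_triangular T"
    and "V = Q ** T ** conj_transpose Q"
    and "D = diag_matrix (\<lambda>j. complex_of_real (1 / cmod (T $ j $ j)) * T $ j $ j)"
  shows "op_norm (U - Q ** D ** conj_transpose Q)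
    \<le> 7 / 10 * sqrt (real CARD('n)) * (op_norm (conj_transpose U ** U - mat 1))\<^sup>2
      + 7 / 10 * op_norm (conj_transpose U ** U - mat 1)"
proof -
  define e where "e = op_norm (conj_transpose U ** U - mat 1)"
  have e: "e \<le> 3 / 4" using assms(2) by (simp add: e_def)
  have e0: "0 \<le> e"
    using order_trans[OF norm_ge_zero norm_le_op_norm[of "conj_transpose U ** U - mat 1" "axis undefined 1"]]
    by (simp add: e_def)
  obtain B w s where B: "finite B" "orthonormal_on B (\<lambda>b. b)" "span B = UNIV"
    and w: "orthonormal_on B w" and Ub: "\<And>b. b \<in> B \<Longrightarrow> U *v b = s b *\<^sub>R w b"
    and s0: "\<And>b. b \<in> B \<Longrightarrow> s b > 0" and se: "\<And>b. b \<in> B \<Longrightarrow> \<bar>(s b)\<^sup>2 - 1\<bar> \<le> e"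
    using singular_system_exists[of U e] e by (auto simp: e_def)
  define f where "f b = (s b + 1 / s b) / 2" for b
  define g where "g b = (f b + 1 / f b) / 2" for b
  have V1b: "V1 *v b = f b *\<^sub>R w b" if "b \<in> B" for b
    unfolding assms(3) f_def using singular_system_averaging[OF B w Ub s0 that] .
  \<comment> \<open>Positivity makes \<open>B\<close>, \<open>w\<close>, \<open>f\<close> a singular
    system of \<open>V1\<close>, so the averaging lemma applies a second time.\<close>
  have f0: "f b > 0" if "b \<in> B" for b
    using s0[OF that] by (simp add: f_def add_pos_pos)
  have Vb: "V *v b = g b *\<^sub>R w b" if "b \<in> B" for b
    unfolding assms(4) g_def using singular_system_averaging[OF B w V1b f0 that] .
  have s: "s b \<ge> 1 / 2" if "b \<in> B" for b
  proof (rule power2_le_imp_le)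
    show "(1 / 2)\<^sup>2 \<le> (s b)\<^sup>2" using se[OF that] e by (simp add: power2_eq_square)
    show "0 \<le> s b" using s0[OF that] by simp
  qed
  note scalar = two_averages_displacement[OF s f_def g_def] two_averages_square[OF s f_def g_def]
  have V_norm: "(norm (V *v x))\<^sup>2 = (\<Sum>b\<in>B. (x \<bullet> b)\<^sup>2 * (g b)\<^sup>2)" for x
    by (rule norm_linear_orthonormal[OF linear_complex_matrix B w Vb])
  have UV: "norm ((U - V) *v x) \<le> 7 / 10 * e * norm x" for x
  proof (rule power2_le_imp_le)
    have UVb: "(U - V) *v b = (s b - g b) *\<^sub>R w b" if "b \<in> B" for b
      using Ub[OF that] Vb[OF that] by (simp add: matrix_vector_mult_diff_rdistrib scaleR_diff_left)
    have "(norm ((U - V) *v x))\<^sup>2 = (\<Sum>b\<in>B. (x \<bullet> b)\<^sup>2 * (s b - g b)\<^sup>2)"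
      by (rule norm_linear_orthonormal[OF linear_complex_matrix B w UVb])
    also have "\<dots> \<le> (\<Sum>b\<in>B. (x \<bullet> b)\<^sup>2 * (7 / 10 * e)\<^sup>2)"
    proof (intro sum_mono mult_left_mono)
      fix b assume b: "b \<in> B"
      have "\<bar>s b - g b\<bar> \<le> 7 / 10 * e"
        using scalar(1)[OF b] by (rule order_trans) (use se[OF b] in simp)
      then show "(s b - g b)\<^sup>2 \<le> (7 / 10 * e)\<^sup>2"
        using e0 by (simp add: abs_le_square_iff[symmetric])
    qed simp
    also have "\<dots> = (7 / 10 * e * norm x)\<^sup>2"
      unfolding power_mult_distrib[of _ "norm x"] norm_orthonormal_basis[OF B]
      by (simp add: sum_distrib_right mult.commute)
    finally show "(norm ((U - V) *v x))\<^sup>2 \<le> (7 / 10 * e * norm x)\<^sup>2" .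
  qed (use e0 in simp)
  have V_lower: "norm x \<le> norm (V *v x)" for x
  proof (rule power2_le_imp_le)
    have "(\<Sum>b\<in>B. (x \<bullet> b)\<^sup>2 * 1) \<le> (\<Sum>b\<in>B. (x \<bullet> b)\<^sup>2 * (g b)\<^sup>2)"
      using scalar(2) by (intro sum_mono mult_left_mono) auto
    then show "(norm x)\<^sup>2 \<le> (norm (V *v x))\<^sup>2"
      using norm_orthonormal_basis[OF B, of x] by (simp add: V_norm)
  qed simp
  \<comment> \<open>The excess is written as a square to match
    \<open>column_diff_phase_bound\<close> with \<open>k = 7 / 10 * e\<^sup>2\<close>.\<close>
  have V_upper: "(norm (V *v x))\<^sup>2 \<le> (1 + (7 / 10 * e\<^sup>2)\<^sup>2) * (norm x)\<^sup>2" for x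
  proof -
    have "(norm (V *v x))\<^sup>2 \<le> (\<Sum>b\<in>B. (x \<bullet> b)\<^sup>2 * (1 + (7 / 10 * e\<^sup>2)\<^sup>2))"
      unfolding V_norm
    proof (intro sum_mono mult_left_mono)
      fix b assume b: "b \<in> B"
      have "((s b)\<^sup>2 - 1) ^ 4 \<le> e ^ 4"
        using power_mono[OF se[OF b], of 4] by (simp add: power_even_abs)
      moreover have "(7 / 10 * e\<^sup>2)\<^sup>2 = 49 / 100 * e ^ 4" by algebra
      ultimately show "(g b)\<^sup>2 \<le> 1 + (7 / 10 * e\<^sup>2)\<^sup>2"
        using scalar(3)[OF b] by linarith
    qed simp
    then show ?thesis
      unfolding norm_orthonormal_basis[OF B, of x] by (simp add: sum_distrib_right mult.commute)
  qed
  have VQ: "V ** Q = Q ** T"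
    using assms(5) by (simp add: assms(7) unitary_def flip: matrix_mul_assoc)
  \<comment> \<open>Unitary invariance carries both norm bounds on \<open>V\<close> over to
    \<open>T\<close>.\<close>
  have T_norm: "norm (T *v x) = norm (V *v (Q *v x))" for x
    using norm_unitary(1)[OF assms(5), of "T *v x"] by (simp add: matrix_vector_mul_assoc VQ)
  have "norm x \<le> norm (T *v x)" for x
    using V_lower[of "Q *v x"] norm_unitary(1)[OF assms(5)] by (simp add: T_norm)
  then have diag: "1 \<le> cmod (T $ j $ j)" for j
    using expanding_upper_triangular_diagonal[OF assms(6)] by blast
  have "norm (column j (T - D)) \<le> 7 / 10 * e\<^sup>2" for j
    unfolding assms(8)
  proof (rule column_diff_phase_bound[OF diag])
    \<comment> \<open>A column is the image of a unit vector, so the upper norm bound controls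
      it.\<close>
    have "column j T = T *v axis j 1"
      by (simp add: vec_eq_iff column_def matrix_vector_mult_def axis_def if_distrib cong: if_cong)
    then show "(norm (column j T))\<^sup>2 \<le> 1 + (7 / 10 * e\<^sup>2)\<^sup>2"
      using V_upper[of "Q *v axis j 1"] norm_unitary(1)[OF assms(5), of "axis j 1"]
      by (simp add: T_norm)
  qed simp
  then have TD: "norm ((T - D) *v x) \<le> sqrt (real CARD('n)) * (7 / 10 * e\<^sup>2) * norm x" for x
    by (rule norm_le_sum_columns)
  have "op_norm (U - Q ** D ** conj_transpose Q)
      \<le> sqrt (real CARD('n)) * (7 / 10 * e\<^sup>2) + 7 / 10 * e"
    unfolding op_norm_def
  proof (rule onorm_le)
    fix x
    \<comment> \<open>Insert \<open>V = Q T Q\<^sup>*\<close>: the error splits into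
      \<open>Q (T - D) Q\<^sup>*\<close>, of order \<open>e\<^sup>2\<close> with the dimension
      factor, and \<open>U - V\<close>, of order \<open>e\<close> without it.\<close>
    have "(U - Q ** D ** conj_transpose Q) *v x
        = Q *v ((T - D) *v (conj_transpose Q *v x)) + (U - V) *v x"
      by (simp only: assms(7) matrix_vector_mult_diff_rdistrib matrix_vector_mult_diff_distrib
          flip: matrix_vector_mul_assoc) simp
    also have "norm \<dots> \<le> norm ((T - D) *v (conj_transpose Q *v x)) + norm ((U - V) *v x)"
      by (rule order_trans[OF norm_triangle_ineq]) (simp only: norm_unitary(1)[OF assms(5)] order_refl)
    also have "\<dots> \<le> sqrt (real CARD('n)) * (7 / 10 * e\<^sup>2) * norm x + 7 / 10 * e * norm x"
      using TD[of "conj_transpose Q *v x"] UV[of x] norm_unitary(2)[OF assms(5)]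
      by (intro add_mono) simp_all
    finally show "norm ((U - Q ** D ** conj_transpose Q) *v x)
        \<le> (sqrt (real CARD('n)) * (7 / 10 * e\<^sup>2) + 7 / 10 * e) * norm x"
      by (simp add: algebra_simps)
  qed
  then show ?thesis
    by (simp add: e_def mult.commute mult.left_commute)
qed

end
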